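(* Let $S = R \cup B$ be a set of $2n$ points in general position (no three collinear) in the plane with $|R| = |B| = n$ (red points $R$, blue points $B$), such that $R$ and $B$ are linearly separable. Then $S$ has at least $\frac{2n^2+3n-8}{12}$ balanced $4$-holes.
   Context: A hole of $S$ is a simple polygon with vertices in $S$ and no point of $S$ in its interior (not necessarily convex); a $4$-hole has $4$ vertices and is balanced if it has exactly two red and two blue vertices. $R$ and $B$ are linearly separable if some line has all of $R$ strictly on one side and all of $B$ strictly on the other. *)

theory Defs
  imports "HOL-Analysis.Analysis"
begin

type_synonym point = "real^2"

definition quad_boundary :: "point \<Rightarrow> point \<Rightarrow> point \<Rightarrow> point \<Rightarrow> point set" where
  "quad_boundary a b c d =
     closed_segment a b \<union> closed_segment b c \<union> closed_segment c d \<union> closed_segment d a"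

definition simple_quad :: "point \<Rightarrow> point \<Rightarrow> point \<Rightarrow> point \<Rightarrow> bool" where
  "simple_quad a b c d \<longleftrightarrow> distinct [a, b, c, d] \<and>
     closed_segment a b \<inter> closed_segment b c = {b} \<and>
     closed_segment b c \<inter> closed_segment c d = {c} \<and>
     closed_segment c d \<inter> closed_segment d a = {d} \<and>
     closed_segment d a \<inter> closed_segment a b = {a} \<and>
     closed_segment a b \<inter> closed_segment c d = {} \<and>
     closed_segment b c \<inter> closed_segment d a = {}"

definition four_hole :: "point set \<Rightarrow> point \<Rightarrow> point \<Rightarrow> point \<Rightarrow> point \<Rightarrow> bool" where
  "four_hole S a b c d \<longleftrightarrow> {a, b, c, d} \<subseteq> S \<and> simple_quad a b c d \<and>
     (\<forall>p\<in>S. p \<notin> inside (quad_boundary a b c d))"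

text \<open>A polygon is identified with its set of edges (independent of starting
  vertex and orientation).\<close>
definition quad_edges :: "point \<Rightarrow> point \<Rightarrow> point \<Rightarrow> point \<Rightarrow> point set set" where
  "quad_edges a b c d = {{a, b}, {b, c}, {c, d}, {d, a}}"

definition balanced_4holes :: "point set \<Rightarrow> point set \<Rightarrow> point set set set" where
  "balanced_4holes R B =
     {quad_edges a b c d | a b c d. four_hole (R \<union> B) a b c d \<and>
        card ({a, b, c, d} \<inter> R) = 2 \<and> card ({a, b, c, d} \<inter> B) = 2}"

definition general_position :: "point set \<Rightarrow> bool" where
  "general_position S \<longleftrightarrow>
     (\<forall>x\<in>S. \<forall>y\<in>S. \<forall>z\<in>S. distinct [x, y, z] \<longrightarrow> \<not> collinear {x, y, z})"

definition linearly_separable :: "point set \<Rightarrow> point set \<Rightarrow> bool" where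
  "linearly_separable R B \<longleftrightarrow>
     (\<exists>u c. u \<noteq> 0 \<and> (\<forall>r\<in>R. inner u r < c) \<and> (\<forall>b\<in>B. inner u b > c))"

end

theory Submission
  imports Defs
begin

text \<open>
  Call a pair of a red point r and a blue point b good if some balanced 4-hole has both among its
  vertices. A balanced 4-hole has four red-blue pairs of vertices, so it suffices to show that at
  most (n^2 - 3n + 2)/3 pairs are not good.

  Consider one side of the line rb that contains both colours, and let xy be the red-blue segment
  on that side which crosses the separating line closest to rb; every point on that side of rb lies
  on or beyond the line xy. If r and b are both in front of xy, then r b y x is a hole. Otherwise,
  say, r is beyond xy. Let b' be the blue point following b in the rotation about r. The triangle
  r b b' contains x and no blue point, and if it contained at most two red points, a hole would
  arise by deleting one of the three triangles into which x splits it. Hence it contains three red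
  points. If this happens with red on one side of rb and with blue on the other, two empty
  triangles over rb form a hole with diagonal rb. So a pair that is not good is, for one of the two
  colours, separated from its rotational neighbours on both sides by three points of that colour.

  The red points separating blue points in the rotation about r are closer to the separating line
  than r, so the r that is i-th closest is in at most (i - 1) div 3 such pairs.
\<close>

section \<open>Orientation and quadrilaterals\<close>

text \<open>Orientation in the coordinates given by the functionals u and v. Replacing v by - v exchanges
  the two sides of every line, and replacing u by - u lets R and B exchange their roles, so all
  symmetric cases below are instances of one another.\<close>

definition ori :: "point \<Rightarrow> point \<Rightarrow> point \<Rightarrow> point \<Rightarrow> point \<Rightarrow> real" where
  "ori u v a b c = (u \<bullet> (b - a)) * (v \<bullet> (c - a)) - (v \<bullet> (b - a)) * (u \<bullet> (c - a))"

text \<open>The open triangle, for positively oriented corners only: by \<open>ori_split\<close> the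
  three conditions sum to \<open>0 < ori u v a b c\<close>.\<close>

definition in_triangle :: "point \<Rightarrow> point \<Rightarrow> point \<Rightarrow> point \<Rightarrow> point \<Rightarrow> point \<Rightarrow> bool" where
  "in_triangle u v a b c p \<longleftrightarrow> 0 < ori u v a b p \<and> 0 < ori u v b c p \<and> 0 < ori u v c a p"

lemma ori_rotate: "ori u v b c a = ori u v a b c"
  by (simp add: ori_def inner_diff_right algebra_simps)

lemma ori_swap: "ori u v b a c = - ori u v a b c"
  by (simp add: ori_def inner_diff_right algebra_simps)

lemma ori_swap': "ori u v a c b = - ori u v a b c"
  by (simp add: ori_def inner_diff_right algebra_simps)

lemma ori_degenerate [simp]: "ori u v a a b = 0" "ori u v a b a = 0" "ori u v b a a = 0"
  by (simp_all add: ori_def)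

lemma ori_uminus_right: "ori u (- v) a b c = - ori u v a b c"
  by (simp add: ori_def)

lemma ori_uminus_left: "ori (- u) v a b c = - ori u v a b c"
  by (simp add: ori_def)

lemma ori_split: "ori u v a b c = ori u v a b p + ori u v b c p + ori u v c a p"
  by (simp add: ori_def inner_diff_right algebra_simps)

text \<open>Signed areas of the subtriangles serve as barycentric weights of p, for p anywhere in
  the plane. Here and in \<open>barycentric_ori\<close> they average an affine function, without
  division.\<close>

lemma barycentric_inner:
  "ori u v a b d * (u \<bullet> p - k) =
     ori u v b d p * (u \<bullet> a - k) + ori u v d a p * (u \<bullet> b - k) + ori u v a b p * (u \<bullet> d - k)"
  by (simp add: ori_def inner_diff_right algebra_simps)

lemma barycentric_ori:
  "ori u v a b d * ori u v x y p =
     ori u v b d p * ori u v x y a + ori u v d a p * ori u v x y b + ori u v a b p * ori u v x y d"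
  unfolding ori_def inner_diff_right by algebra

lemma ori_combination:
  assumes "\<alpha> + \<beta> + \<gamma> = 1"
  shows "ori u v x y (\<alpha> *\<^sub>R a + \<beta> *\<^sub>R b + \<gamma> *\<^sub>R d) =
    \<alpha> * ori u v x y a + \<beta> * ori u v x y b + \<gamma> * ori u v x y d"
proof -
  have "\<alpha> = 1 - \<beta> - \<gamma>" using assms by simp
  then show ?thesis
    unfolding ori_def inner_diff_right inner_add_right inner_scaleR_right by algebra
qed

lemma ori_segment:
  "ori u v x y ((1 - t) *\<^sub>R a + t *\<^sub>R b) = (1 - t) * ori u v x y a + t * ori u v x y b"
  using ori_combination[of "1 - t" t 0] by simp

lemma in_triangle_trans:
  assumes p: "in_triangle u v a b d p" and q: "in_triangle u v a b p q"
  shows "in_triangle u v a b d q"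
proof -
  have pos: "0 < ori u v a b p" "0 < ori u v b d p" "0 < ori u v d a p"
    "0 < ori u v a b q" "0 < ori u v b p q" "0 < ori u v p a q"
    using p q by (auto simp: in_triangle_def)
  have abd: "0 < ori u v a b d" using ori_split[of u v a b d p] pos by linarith
  then have abd': "0 < ori u v b d a" "0 < ori u v d a b" by (simp_all add: ori_rotate)
  have "0 < ori u v a b p * ori u v b d q"
    unfolding barycentric_ori[of u v a b p b d q] using pos abd'
    by (simp add: add_pos_pos)
  moreover have "0 < ori u v a b p * ori u v d a q"
    unfolding barycentric_ori[of u v a b p d a q] using pos abd'
    by (simp add: add_pos_pos)
  ultimately show ?thesis using pos by (simp add: in_triangle_def zero_less_mult_iff)
qed

lemma in_triangle_rotate: "in_triangle u v b c a p \<longleftrightarrow> in_triangle u v a b c p"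
  by (auto simp: in_triangle_def)

lemma in_triangle_flip: "in_triangle u (- v) a c b p \<longleftrightarrow> in_triangle u v a b c p"
  by (auto simp: in_triangle_def ori_uminus_right ori_swap[of u v a c p] ori_swap[of u v c b p]
      ori_swap[of u v b a p])

lemma collinear_if_ori_eq_0:
  assumes indep: "\<And>z. u \<bullet> z = 0 \<Longrightarrow> v \<bullet> z = 0 \<Longrightarrow> z = 0"
    and zero: "ori u v a b c = 0"
  shows "collinear {a, b, c}"
proof (cases "a = b")
  case True
  then show ?thesis by simp
next
  case False
  define p q where "p = b - a" and "q = c - a"
  have e: "(u \<bullet> p) * (v \<bullet> q) = (v \<bullet> p) * (u \<bullet> q)"
    using zero by (simp add: ori_def p_def q_def)
  \<comment> \<open>Both u and v kill this combination and the next. As p is not 0, one of its two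
    coordinates is nonzero and serves as m.\<close>
  have "(u \<bullet> p) *\<^sub>R q - (u \<bullet> q) *\<^sub>R p = 0"
    by (rule indep) (use e in \<open>simp_all add: inner_diff_right algebra_simps\<close>)
  moreover have "(v \<bullet> p) *\<^sub>R q - (v \<bullet> q) *\<^sub>R p = 0"
    by (rule indep) (use e in \<open>simp_all add: inner_diff_right algebra_simps\<close>)
  moreover have "p \<noteq> 0" using False p_def by simp
  ultimately obtain m k :: real where "m \<noteq> 0" "m *\<^sub>R q = k *\<^sub>R p"
    using indep[of p] by (metis eq_iff_diff_eq_0)
  then have "q = (k / m) *\<^sub>R p"
    by (metis divide_inverse_commute left_inverse scaleR_one scaleR_scaleR)
  then have "collinear {0, p, q}" by (auto simp: collinear_lemma)
  then have "collinear {b, a, c}" by (simp add: collinear_3[of b a c] p_def q_def)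
  then show ?thesis by (simp add: insert_commute)
qed

section \<open>Simple quadrilaterals and what their boundary encloses\<close>

lemma segments_meet_in_common_end:
  assumes "ori u v a b d \<noteq> 0"
  shows "closed_segment a b \<inter> closed_segment a d = {a}"
proof -
  have "z = a" if z: "z \<in> closed_segment a b" "z \<in> closed_segment a d" for z
  proof -
    obtain s t where s: "z = (1 - s) *\<^sub>R a + s *\<^sub>R b" and t: "z = (1 - t) *\<^sub>R a + t *\<^sub>R d"
      using z unfolding in_segment by metis
    have "t * ori u v a b d = ori u v a b z" using t by (simp add: ori_segment)
    also have "\<dots> = 0" unfolding s by (simp add: ori_segment)
    finally show ?thesis using assms t by simp
  qed
  then show ?thesis by auto
qed

text \<open>The line of the diagonal b d separates a from c, so the sides at a and the sides at c
  can meet only on it, in b or d. The quadrilateral may be reflex at b or d.\<close>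

lemma simple_quad_of_triangles:
  assumes abd: "0 < ori u v a b d" and bcd: "0 < ori u v b c d"
  shows "simple_quad a b c d"
proof -
  have fa: "ori u v b d a > 0" using abd by (simp add: ori_rotate)
  have fc: "ori u v b d c < 0" using bcd by (simp add: ori_swap' [of u v b d c])
  have upper: "ori u v b d z \<ge> 0 \<and> (ori u v b d z = 0 \<longrightarrow> z = w)"
    if "z \<in> closed_segment a w" "w = b \<or> w = d" for z w
    using that fa by (auto simp: in_segment ori_segment)
  have lower: "ori u v b d z \<le> 0 \<and> (ori u v b d z = 0 \<longrightarrow> z = w)"
    if "z \<in> closed_segment c w" "w = b \<or> w = d" for z w
    using that fc by (auto simp: in_segment ori_segment mult_nonneg_nonpos)
  have ne: "distinct [a, b, c, d]" using abd bcd fa fc by (auto simp: ori_degenerate)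
  have "closed_segment a b \<inter> closed_segment b c = {b}"
    using upper[of _ b] lower[of _ b]
    by (auto simp: closed_segment_commute[of b c]) (meson dual_order.antisym)
  moreover have "closed_segment c d \<inter> closed_segment d a = {d}"
    using upper[of _ d] lower[of _ d]
    by (auto simp: closed_segment_commute[of d a]) (meson dual_order.antisym)
  moreover have "closed_segment a b \<inter> closed_segment c d = {}"
    using upper[of _ b] lower[of _ d] ne by auto (metis dual_order.antisym)
  moreover have "closed_segment b c \<inter> closed_segment d a = {}"
    using upper[of _ d] lower[of _ b] ne
    by (auto simp: closed_segment_commute[of d a] closed_segment_commute[of b c])
       (metis dual_order.antisym)
  moreover have "closed_segment b c \<inter> closed_segment c d = {c}"
    using segments_meet_in_common_end[of u v c b d] bcd
    by (simp add: closed_segment_commute[of b c] ori_swap[of u v c b d])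
  moreover have "closed_segment d a \<inter> closed_segment a b = {a}"
    using segments_meet_in_common_end[of u v a b d] abd
    by (simp add: closed_segment_commute[of d a] Int_commute)
  ultimately show ?thesis using ne by (simp add: simple_quad_def)
qed

text \<open>A point outside K escapes to infinity along the ray leading away from the star centre w:
  meeting K later would put the point itself in K. So its component of the complement of X is
  unbounded.\<close>

lemma inside_subset_starlike:
  fixes K :: "'a::real_normed_vector set"
  assumes "X \<subseteq> K" and star: "\<And>y. y \<in> K \<Longrightarrow> closed_segment w y \<subseteq> K" and "w \<in> K"
  shows "inside X \<subseteq> K"
proof
  fix p assume p: "p \<in> inside X"
  show "p \<in> K"
  proof (rule ccontr)
    assume np: "p \<notin> K"
    then have dp: "p - w \<noteq> 0" using assms(3) by auto
    define L where "L = (\<lambda>t::real. w + t *\<^sub>R (p - w)) ` {1..}"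
    have "connected L" unfolding L_def
      by (intro connected_continuous_image continuous_intros) simp
    moreover have "p \<in> L" unfolding L_def by (rule image_eqI[of _ _ 1]) auto
    moreover have "L \<subseteq> - X"
    proof -
      have False if "t \<ge> 1" "w + t *\<^sub>R (p - w) \<in> K" for t
      proof -
        have "p \<in> closed_segment w (w + t *\<^sub>R (p - w))"
          unfolding in_segment
          by (rule exI[of _ "1 / t"]) (use that in \<open>auto simp: algebra_simps\<close>)
        then show False using star[OF that(2)] np by blast
      qed
      then show ?thesis using assms(1) by (auto simp: L_def)
    qed
    ultimately have sub: "L \<subseteq> connected_component_set (- X) p"
      by (simp add: connected_component_maximal)
    have "bounded L" using p sub by (auto simp: inside_def intro: bounded_subset)
    then obtain M where M: "\<And>z. z \<in> L \<Longrightarrow> norm z \<le> M" by (auto simp: bounded_iff)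
    \<comment> \<open>Chosen so that the point of the ray at parameter t has norm greater than
      M.\<close>
    define t where "t = 1 + (\<bar>M\<bar> + norm w) / norm (p - w)"
    have "t \<ge> 1" by (simp add: t_def)
    then have "norm (w + t *\<^sub>R (p - w)) \<le> M" by (intro M) (auto simp: L_def)
    moreover have "norm (t *\<^sub>R (p - w)) \<le> norm (w + t *\<^sub>R (p - w)) + norm w"
      by (metis add_diff_cancel_left' norm_triangle_ineq4)
    moreover have "norm (t *\<^sub>R (p - w)) = t * norm (p - w)" using \<open>t \<ge> 1\<close> by simp
    moreover have "t * norm (p - w) = norm (p - w) + \<bar>M\<bar> + norm w"
      using dp by (simp add: t_def field_simps)
    moreover have "norm (p - w) > 0" using dp by simp
    ultimately show False by linarith
  qed
qed

text \<open>Both triangles have the corner b, so their union is star-shaped about b even where it is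
  not convex.\<close>

lemma inside_quad_boundary_subset:
  "inside (quad_boundary a b c d) \<subseteq> convex hull {a, b, d} \<union> convex hull {b, c, d}"
proof (rule inside_subset_starlike)
  let ?K = "convex hull {a, b, d} \<union> convex hull {b, c, d}"
  have "closed_segment x y \<subseteq> convex hull T" if "x \<in> T" "y \<in> T" for x y and T :: "point set"
    using that by (simp add: closed_segment_subset hull_inc)
  then show "quad_boundary a b c d \<subseteq> ?K"
    unfolding quad_boundary_def by (metis Un_least insertI1 insertI2 le_supI1 le_supI2)
  show "closed_segment b y \<subseteq> ?K" if "y \<in> ?K" for y
    using that by (metis Un_iff closed_segment_subset convex_convex_hull hull_inc insertI1 insertI2
        le_supI1 le_supI2)
  show "b \<in> ?K" by (simp add: hull_inc)
qed

lemma in_triangle_if_in_hull: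
  assumes ori: "0 < ori u v a b d" and p: "p \<in> convex hull {a, b, d}"
    and nz: "ori u v a b p \<noteq> 0" "ori u v b d p \<noteq> 0" "ori u v d a p \<noteq> 0"
  shows "in_triangle u v a b d p"
proof -
  obtain \<alpha> \<beta> \<gamma> where w: "\<alpha> \<ge> 0" "\<beta> \<ge> 0" "\<gamma> \<ge> 0" "\<alpha> + \<beta> + \<gamma> = 1"
    and pe: "p = \<alpha> *\<^sub>R a + \<beta> *\<^sub>R b + \<gamma> *\<^sub>R d"
    using p by (auto simp: convex_hull_3)
  have "ori u v a b p = \<gamma> * ori u v a b d" "ori u v b d p = \<alpha> * ori u v a b d"
    "ori u v d a p = \<beta> * ori u v a b d"
    unfolding pe ori_combination[OF w(4)] by (simp_all add: ori_rotate)
  then show ?thesis using w nz ori by (auto simp: in_triangle_def less_le)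
qed

lemma four_hole_of_triangles:
  assumes indep: "\<And>z. u \<bullet> z = 0 \<Longrightarrow> v \<bullet> z = 0 \<Longrightarrow> z = 0"
    and gp: "general_position S" and S: "{a, b, c, d} \<subseteq> S"
    and abd: "0 < ori u v a b d" and bcd: "0 < ori u v b c d"
    and empty: "\<And>p. p \<in> S \<Longrightarrow> \<not> in_triangle u v a b d p" "\<And>p. p \<in> S \<Longrightarrow> \<not> in_triangle u v b c d p"
  shows "four_hole S a b c d"
proof -
  have "p \<notin> inside (quad_boundary a b c d)" if "p \<in> S" for p
  proof
    assume p: "p \<in> inside (quad_boundary a b c d)"
    then have "p \<notin> quad_boundary a b c d" by (simp add: inside_def)
    then have ne: "p \<noteq> a" "p \<noteq> b" "p \<noteq> c" "p \<noteq> d" by (auto simp: quad_boundary_def)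
    have sq: "distinct [a, b, c, d]"
      using simple_quad_of_triangles[OF abd bcd] by (simp add: simple_quad_def)
    have nz: "ori u v x y p \<noteq> 0" if "x \<in> {a, b, c, d}" "y \<in> {a, b, c, d}" "x \<noteq> y" for x y
    proof
      assume "ori u v x y p = 0"
      then have "collinear {x, y, p}" using collinear_if_ori_eq_0 indep by blast
      moreover have "distinct [x, y, p]" using that ne by auto
      ultimately show False using gp S that(1,2) \<open>p \<in> S\<close> unfolding general_position_def by blast
    qed
    have "p \<in> convex hull {a, b, d} \<or> p \<in> convex hull {b, c, d}"
      using p inside_quad_boundary_subset by blast
    then show False
      using in_triangle_if_in_hull[OF abd] in_triangle_if_in_hull[OF bcd] nz empty[OF \<open>p \<in> S\<close>] sq
      by auto
  qed
  then show ?thesis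
    using S simple_quad_of_triangles[OF abd bcd] by (simp add: four_hole_def)
qed

section \<open>Counting gaps\<close>

text \<open>At most \<open>card F\<close> / 3 of the disjoint gaps can hold three points of F. The
  work is to charge distinct bad keys to distinct such gaps, although an extreme key has a gap on
  one side only.\<close>

lemma card_gap_bound:
  fixes K :: "real set" and F :: "'a set" and k :: "'a \<Rightarrow> real"
  assumes K: "finite K" and F: "finite F" and less: "card F < card K" and two: "2 \<le> card K"
    and Bad: "Bad \<subseteq> K"
    and gap: "\<And>s t. s \<in> K \<Longrightarrow> t \<in> K \<Longrightarrow> s < t \<Longrightarrow> K \<inter> {s<..<t} = {} \<Longrightarrow> s \<in> Bad \<or> t \<in> Bad
      \<Longrightarrow> 3 \<le> card {x \<in> F. s < k x \<and> k x < t}"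
  shows "3 * card Bad \<le> card F"
proof -
  define succ where "succ s = Min (K \<inter> {s<..})" for s
  define prev where "prev t = Max (K \<inter> {..<t})" for t
  \<comment> \<open>A gap is named by its lower end, so all keys but the largest name one.\<close>
  define N where "N = K - {Max K}"
  define W where "W s = {x \<in> F. s < k x \<and> k x < succ s}" for s
  define Big where "Big = {s \<in> N. 3 \<le> card (W s)}"
  have Kne: "K \<noteq> {}" using two by auto
  have succ: "succ s \<in> K" "s < succ s" "K \<inter> {s<..<succ s} = {}" if "s \<in> N" for s
  proof -
    have "s < Max K" using that K by (auto simp: N_def less_le)
    then have ne: "K \<inter> {s<..} \<noteq> {}" using Max_in[OF K Kne] by auto
    then have "succ s \<in> K \<inter> {s<..}" unfolding succ_def using K by (intro Min_in) auto
    then show "succ s \<in> K" "s < succ s" by auto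
    show "K \<inter> {s<..<succ s} = {}"
    proof -
      have False if "t \<in> K" "s < t" "t < succ s" for t
      proof -
        have "Min (K \<inter> {s<..}) \<le> t" using K that by (intro Min_le) auto
        then show False using that(3) by (simp add: succ_def)
      qed
      then show ?thesis by auto
    qed
  qed
  have prev: "prev t \<in> K" "prev t < t" "K \<inter> {prev t<..<t} = {}" "s \<le> prev t"
    if "t \<in> K" "s \<in> K" "s < t" for s t
  proof -
    have ne: "K \<inter> {..<t} \<noteq> {}" using that by auto
    then have "prev t \<in> K \<inter> {..<t}" unfolding prev_def using K by (intro Max_in) auto
    then show "prev t \<in> K" "prev t < t" by auto
    have m: "x \<le> prev t" if "x \<in> K" "x < t" for x
      unfolding prev_def using K that by (intro Max_ge) auto
    then show "K \<inter> {prev t<..<t} = {}" by fastforce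
    show "s \<le> prev t" using m that by blast
  qed
  have finN: "finite N" using K by (simp add: N_def)
  have disj: "W s \<inter> W t = {}" if "s \<in> N" "t \<in> N" "s < t" for s t
  proof -
    have "succ s \<le> t" using succ(3)[OF that(1)] that by (force simp: N_def)
    then show ?thesis by (auto simp: W_def)
  qed
  have "(\<Sum>s\<in>Big. card (W s)) = card (\<Union>s\<in>Big. W s)"
  proof (rule card_UN_disjoint[symmetric])
    show "finite Big" using finN by (simp add: Big_def)
    show "\<forall>s\<in>Big. finite (W s)" using F by (simp add: W_def)
    show "\<forall>s\<in>Big. \<forall>t\<in>Big. s \<noteq> t \<longrightarrow> W s \<inter> W t = {}"
      using disj unfolding Big_def by (metis (no_types, lifting) Int_commute linorder_neqE mem_Collect_eq)
  qed
  also have "\<dots> \<le> card F" using F by (intro card_mono) (auto simp: W_def)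
  finally have "(\<Sum>s\<in>Big. card (W s)) \<le> card F" .
  moreover have "(\<Sum>s\<in>Big. 3) \<le> (\<Sum>s\<in>Big. card (W s))" by (intro sum_mono) (simp add: Big_def)
  ultimately have big: "3 * card Big \<le> card F" by simp
  have cN: "card N = card K - 1" using K Kne by (simp add: N_def)
  \<comment> \<open>\<open>3 * card Big \<le> card F \<le> card N\<close>, and \<open>card N\<close>
    is positive because K has two elements.\<close>
  then have "card Big < card N" using big less two by linarith
  then have "\<not> N \<subseteq> Big" using finN by (metis Big_def card_mono finite_Collect_conjI finite_subset leD mem_Collect_eq subsetI)
  then obtain g where g: "g \<in> N" "g \<notin> Big" by auto
  then have gK: "g \<in> K" by (simp add: N_def)
  have up: "s \<in> Big" if "s \<in> N" "s \<in> Bad" for s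
    using gap[of s "succ s"] succ[of s] that by (auto simp: Big_def W_def N_def)
  have down: "prev t \<in> Big \<and> g < prev t" if "t \<in> Bad" "g < t" for t
  proof -
    have tK: "t \<in> K" using that Bad by auto
    note p = prev[OF tK gK that(2)]
    have pN: "prev t \<in> N" using p(1,2) tK K by (auto simp: N_def dest: Max_ge[OF K])
    have "succ (prev t) = t"
      using succ[OF pN] p tK by (metis (no_types, lifting) Int_iff emptyE greaterThanLessThan_iff linorder_neqE)
    then have "prev t \<in> Big" using gap[OF p(1) tK p(2,3)] that pN by (simp add: Big_def W_def)
    then show ?thesis using p(4) g by (metis less_le)
  qed
  \<comment> \<open>The gap above g is small; charge bad points above g to the gap below them, the others to
    the gap above them.\<close>
  define f where "f t = (if t < g then t else prev t)" for t
  \<comment> \<open>The gap above g is small, so g itself is not bad.\<close>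
  have ng: "t \<noteq> g" if "t \<in> Bad" for t using up g that by auto
  have "inj_on f Bad"
  proof (rule inj_onI)
    have aux: "prev s \<noteq> prev t" if "s \<in> Bad" "t \<in> Bad" "g < s" "s < t" for s t
      using prev(4)[of t s] prev(2)[of s g] that Bad gK by (metis leD subsetD)
    fix s t assume st: "s \<in> Bad" "t \<in> Bad" "f s = f t"
    then consider "s < g" "t < g" | "s < g" "g < t" | "g < s" "t < g" | "g < s" "g < t"
      using ng by (metis linorder_neqE)
    then show "s = t"
    proof cases
      case 4
      then show ?thesis using st aux[of s t] aux[of t s] by (auto simp: f_def) (metis linorder_neqE)
    qed (use st down[of s] down[of t] in \<open>auto simp: f_def\<close>)
  qed
  moreover have "f ` Bad \<subseteq> Big"
  proof -
    have "f t \<in> Big" if "t \<in> Bad" for t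
    proof (cases "t < g")
      case True
      have "t \<in> N" using that Bad True Max_ge[OF K gK] by (auto simp: N_def)
      then show ?thesis using True up that by (simp add: f_def)
    next
      case False
      then show ?thesis using down[OF that] ng[OF that] by (auto simp: f_def)
    qed
    then show ?thesis by auto
  qed
  moreover have "finite Big" using finN by (simp add: Big_def)
  ultimately have "card Bad \<le> card Big" using card_inj_on_le by blast
  then show ?thesis using big by linarith
qed

text \<open>Listed from the largest f down, the element at position i, counted from 0, has at most i
  elements strictly above it; ties only lower the count. Removing a minimal element leaves the other
  counts unchanged.\<close>

lemma sum_card_above_div_3:
  fixes f :: "'a \<Rightarrow> real"
  assumes "finite A"
  shows "(\<Sum>a\<in>A. card {x \<in> A. f a < f x} div 3) \<le> (\<Sum>i<card A. i div 3)"
  using assms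
proof (induction "card A" arbitrary: A)
  case 0
  then show ?case by simp
next
  case (Suc m)
  then have "A \<noteq> {}" by auto
  define a where "a = arg_min_on f A"
  have a: "a \<in> A" "\<And>x. x \<in> A \<Longrightarrow> f a \<le> f x"
    using arg_min_if_finite[OF Suc.prems \<open>A \<noteq> {}\<close>, of f] by (auto simp: a_def not_less)
  let ?A = "A - {a}"
  have cA: "card ?A = m" using Suc a by simp
  have eq: "card {x \<in> A. f y < f x} div 3 = card {x \<in> ?A. f y < f x} div 3" if "y \<in> A" for y
  proof -
    have "{x \<in> A. f y < f x} = {x \<in> ?A. f y < f x}" using a(2)[OF that] by auto
    then show ?thesis by simp
  qed
  have "(\<Sum>y\<in>A. card {x \<in> A. f y < f x} div 3) = (\<Sum>y\<in>A. card {x \<in> ?A. f y < f x} div 3)"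
    by (rule sum.cong[OF refl eq])
  also have "\<dots> = card {x \<in> ?A. f a < f x} div 3 + (\<Sum>y\<in>?A. card {x \<in> ?A. f y < f x} div 3)"
    by (rule sum.remove[OF Suc.prems a(1)])
  also have "\<dots> \<le> m div 3 + (\<Sum>i<m. i div 3)"
  proof (rule add_mono)
    have "card {x \<in> ?A. f a < f x} \<le> card ?A" by (rule card_mono) (use Suc.prems in auto)
    then show "card {x \<in> ?A. f a < f x} div 3 \<le> m div 3" using cA by (simp add: div_le_mono)
    show "(\<Sum>y\<in>?A. card {x \<in> ?A. f y < f x} div 3) \<le> (\<Sum>i<m. i div 3)"
      using Suc.hyps(1)[of ?A] cA Suc.prems by simp
  qed
  finally show ?case by (simp flip: Suc.hyps(2) add: add.commute)
qed

text \<open>Blocks of three equal terms give the closed form \<open>third\<close>. The constant 2 is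
  attained when n is not a multiple of 3.\<close>

lemma sum_div_3_le: "6 * (\<Sum>i<n. i div 3) + 3 * n \<le> n ^ 2 + (2::nat)"
proof -
  have third: "2 * (\<Sum>i<3 * q. i div 3) + 3 * q = 3 * q ^ 2" for q :: nat
  proof (induction q)
    case (Suc q)
    have "3 * Suc q = Suc (Suc (Suc (3 * q)))" by simp
    moreover have "Suc (3 * q) div 3 = q" "Suc (Suc (3 * q)) div 3 = q" by presburger+
    ultimately have "(\<Sum>i<3 * Suc q. i div 3) = (\<Sum>i<3 * q. i div 3) + 3 * q"
      by (simp only: sum.lessThan_Suc)
    then show ?case using Suc by (simp add: power2_eq_square)
  qed simp
  define q where "q = n div 3"
  consider "n = 3 * q" | "n = Suc (3 * q)" | "n = Suc (Suc (3 * q))"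
    unfolding q_def by linarith
  then show ?thesis
  proof cases
    case 1
    then show ?thesis using third[of q] by (simp add: power2_eq_square algebra_simps)
  next
    case 2
    then show ?thesis using third[of q] by (simp add: power2_eq_square algebra_simps)
  next
    case 3
    moreover have "Suc (3 * q) div 3 = q" by presburger
    ultimately show ?thesis using third[of q] by (simp add: power2_eq_square algebra_simps)
  qed
qed

section \<open>Pairs that are not in a balanced 4-hole\<close>

definition in_balanced_4hole :: "point set \<Rightarrow> point set \<Rightarrow> point \<Rightarrow> point \<Rightarrow> bool" where
  "in_balanced_4hole R B p q \<longleftrightarrow> (\<exists>a b c d. four_hole (R \<union> B) a b c d \<and>
     card ({a, b, c, d} \<inter> R) = 2 \<and> card ({a, b, c, d} \<inter> B) = 2 \<and> {p, q} \<subseteq> {a, b, c, d})"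

lemma in_balanced_4hole_swap: "in_balanced_4hole B R q p \<longleftrightarrow> in_balanced_4hole R B p q"
  unfolding in_balanced_4hole_def by (simp add: Un_commute conj_commute conj_left_commute)

text \<open>In use, B lies on one side of the line through r parallel to the separating line, so
  orientation about r orders B linearly. The weak inequality admits q = b'.\<close>

definition next_around :: "point \<Rightarrow> point \<Rightarrow> point set \<Rightarrow> point \<Rightarrow> point \<Rightarrow> point \<Rightarrow> bool" where
  "next_around u v B r b b' \<longleftrightarrow>
     b' \<in> B \<and> 0 < ori u v r b b' \<and> (\<forall>q\<in>B. 0 < ori u v r b q \<longrightarrow> 0 \<le> ori u v r b' q)"

text \<open>True by default when no point of B follows b, so an outermost point is crowded on its
  outer side.\<close>

definition crowded :: "point \<Rightarrow> point \<Rightarrow> point set \<Rightarrow> point set \<Rightarrow> point \<Rightarrow> point \<Rightarrow> bool" where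
  "crowded u v R B r b \<longleftrightarrow>
     (\<forall>b'. next_around u v B r b b' \<longrightarrow> 3 \<le> card {x \<in> R. in_triangle u v r b b' x})"

text \<open>Used for both colours: exchanging R with B, r with b and u with - u gives the blue version.\<close>

definition red_side :: "point \<Rightarrow> point \<Rightarrow> point set \<Rightarrow> point set \<Rightarrow> point \<Rightarrow> point \<Rightarrow> bool" where
  "red_side u v R B r b \<longleftrightarrow> crowded u v R B r b \<and>
     (\<exists>x\<in>R. 0 < ori u v r b x \<and> (\<forall>q\<in>R \<union> B. \<not> in_triangle u v r b x q))"

locale separated_sets =
  fixes R B :: "point set" and u v :: point and c :: real
  assumes finite: "finite R" "finite B"
    and indep: "\<And>z. u \<bullet> z = 0 \<Longrightarrow> v \<bullet> z = 0 \<Longrightarrow> z = 0"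
    and gp: "general_position (R \<union> B)"
    and red: "\<And>r. r \<in> R \<Longrightarrow> u \<bullet> r < c"
    and blue: "\<And>b. b \<in> B \<Longrightarrow> c < u \<bullet> b"
begin

abbreviation D :: "point \<Rightarrow> point \<Rightarrow> point \<Rightarrow> real" where "D \<equiv> ori u v"
abbreviation T :: "point \<Rightarrow> point \<Rightarrow> point \<Rightarrow> point \<Rightarrow> bool" where "T \<equiv> in_triangle u v"
abbreviation good :: "point \<Rightarrow> point \<Rightarrow> bool" where "good \<equiv> in_balanced_4hole R B"

lemma flip: "separated_sets R B u (- v) c"
  by unfold_locales (use finite indep gp red blue in auto)

lemma swap: "separated_sets B R (- u) v (- c)"
  by unfold_locales (use finite indep gp red blue in \<open>auto simp: Un_commute\<close>)

lemma disjoint: "x \<in> R \<Longrightarrow> x \<notin> B" using red blue by force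

lemma D_nonzero:
  assumes "x \<in> R \<union> B" "y \<in> R \<union> B" "z \<in> R \<union> B" "distinct [x, y, z]"
  shows "D x y z \<noteq> 0"
  using assms gp collinear_if_ori_eq_0[OF indep] unfolding general_position_def by blast

lemma goodI:
  assumes rb: "r \<in> R" "r' \<in> R" "b \<in> B" "b' \<in> B" "r \<noteq> r'" "b \<noteq> b'"
    and eq: "{x, y, z, w} = {r, r', b, b'}"
    and o: "0 < D x y w" "0 < D y z w"
    and e: "\<And>p. p \<in> R \<union> B \<Longrightarrow> \<not> T x y w p" "\<And>p. p \<in> R \<union> B \<Longrightarrow> \<not> T y z w p"
  shows "good r b"
proof -
  have "four_hole (R \<union> B) x y z w"
    using rb by (intro four_hole_of_triangles[OF indep gp _ o e]) (auto simp: eq)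
  moreover have "{x, y, z, w} \<inter> R = {r, r'}" "{x, y, z, w} \<inter> B = {b, b'}"
    unfolding eq using rb disjoint by auto
  moreover have "{r, b} \<subseteq> {x, y, z, w}" unfolding eq by auto
  ultimately show ?thesis
    unfolding in_balanced_4hole_def using rb(5,6) by (metis card_2_iff)
qed

section \<open>The bridge on one side of a red-blue pair\<close>

lemma obtain_bridge:
  assumes "R' \<subseteq> R" "B' \<subseteq> B" "R' \<noteq> {}" "B' \<noteq> {}"
  obtains x y where "x \<in> R'" "y \<in> B'" "\<And>p. p \<in> R' \<union> B' \<Longrightarrow> 0 \<le> D x y p"
proof -
  \<comment> \<open>The segment from x to y crosses the separating line at height h (x, y); take the lowest.\<close>
  define h where "h = (\<lambda>(x, y). ((c - u \<bullet> x) * (v \<bullet> y) + (u \<bullet> y - c) * (v \<bullet> x)) / (u \<bullet> y - u \<bullet> x))"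
  have fin: "finite (R' \<times> B')" using assms finite by (auto intro: finite_subset)
  have ne: "R' \<times> B' \<noteq> {}" using assms by auto
  define m where "m = arg_min_on h (R' \<times> B')"
  obtain x y where m: "m = (x, y)" by (cases m)
  have xy: "x \<in> R'" "y \<in> B'" using arg_min_if_finite(1)[OF fin ne, of h] m by (auto simp: m_def)
  have min: "h (x, y) \<le> h (x', y')" if "x' \<in> R'" "y' \<in> B'" for x' y'
    using arg_min_if_finite(2)[OF fin ne, of h] that unfolding m_def[symmetric] m
    by (meson SigmaI linorder_not_less)
  have ux: "u \<bullet> x < c" "c < u \<bullet> y" using xy assms red blue by auto
  have "0 \<le> D x y p" if "p \<in> R'" for p
  proof -
    have up: "u \<bullet> p < c" using that assms red by auto
    \<comment> \<open>With denominators cleared: replacing the end x by p changes the height by a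
      positive multiple of \<open>D x y p\<close>, so minimality gives the sign. The blue end is
      treated likewise below.\<close>
    have "((c - u \<bullet> p) * (v \<bullet> y) + (u \<bullet> y - c) * (v \<bullet> p)) * (u \<bullet> y - u \<bullet> x)
        - ((c - u \<bullet> x) * (v \<bullet> y) + (u \<bullet> y - c) * (v \<bullet> x)) * (u \<bullet> y - u \<bullet> p) = D x y p * (u \<bullet> y - c)"
      unfolding ori_def inner_diff_right by algebra
    moreover have "(u \<bullet> y - u \<bullet> p) \<noteq> 0" "u \<bullet> y - u \<bullet> x \<noteq> 0" using ux up by linarith+
    ultimately have "h (p, y) - h (x, y) = D x y p * ((u \<bullet> y - c) / ((u \<bullet> y - u \<bullet> x) * (u \<bullet> y - u \<bullet> p)))"
      unfolding h_def by (simp add: diff_frac_eq mult.commute)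
    moreover have "0 < (u \<bullet> y - c) / ((u \<bullet> y - u \<bullet> x) * (u \<bullet> y - u \<bullet> p))" using ux up by simp
    ultimately show ?thesis using min[OF that xy(2)]
      by (metis diff_ge_0_iff_ge zero_le_mult_iff linorder_not_less)
  qed
  moreover have "0 \<le> D x y p" if "p \<in> B'" for p
  proof -
    have up: "c < u \<bullet> p" using that assms blue by auto
    have "((c - u \<bullet> x) * (v \<bullet> p) + (u \<bullet> p - c) * (v \<bullet> x)) * (u \<bullet> y - u \<bullet> x)
        - ((c - u \<bullet> x) * (v \<bullet> y) + (u \<bullet> y - c) * (v \<bullet> x)) * (u \<bullet> p - u \<bullet> x) = D x y p * (c - u \<bullet> x)"
      unfolding ori_def inner_diff_right by algebra
    moreover have "(u \<bullet> p - u \<bullet> x) \<noteq> 0" "u \<bullet> y - u \<bullet> x \<noteq> 0" using ux up by linarith+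
    ultimately have "h (x, p) - h (x, y) = D x y p * ((c - u \<bullet> x) / ((u \<bullet> y - u \<bullet> x) * (u \<bullet> p - u \<bullet> x)))"
      unfolding h_def by (simp add: diff_frac_eq mult.commute)
    moreover have "0 < (c - u \<bullet> x) / ((u \<bullet> y - u \<bullet> x) * (u \<bullet> p - u \<bullet> x))" using ux up by simp
    ultimately show ?thesis using min[OF xy(1) that]
      by (metis diff_ge_0_iff_ge zero_le_mult_iff linorder_not_less)
  qed
  ultimately show ?thesis using that xy by blast
qed

text \<open>A point inside the triangle b y r or y x r would lie on the positive side of r b but
  strictly in front of x y, against \<open>bridge\<close>.\<close>

lemma good_if_below_bridge:
  assumes r: "r \<in> R" and b: "b \<in> B" and x: "x \<in> R" "0 < D r b x" and y: "y \<in> B" "0 < D r b y"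
    and bridge: "\<And>p. p \<in> R \<union> B \<Longrightarrow> 0 < D r b p \<Longrightarrow> 0 \<le> D x y p"
    and below: "D x y r < 0" "D x y b < 0"
  shows "good r b"
proof (rule goodI[of r x b y b y x r])
  show "r \<in> R" "x \<in> R" "b \<in> B" "y \<in> B" by fact+
  show "r \<noteq> x" "b \<noteq> y" using x y by auto
  show "{b, y, x, r} = {r, x, b, y}" by auto
  show byr: "0 < D b y r" using y(2) by (simp add: ori_rotate[of u v b y r])
  show yxr: "0 < D y x r" using below by (simp add: ori_swap[of u v y x r])
  fix p assume p: "p \<in> R \<union> B"
  show "\<not> T b y r p"
  proof
    assume t: "T b y r p"
    then have pos: "0 < D b y p" "0 < D y r p" "0 < D r b p" by (auto simp: in_triangle_def)
    have "D b y r * D x y p < 0"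
      unfolding barycentric_ori[of u v b y r x y p] using pos below
      by (simp add: add_neg_neg mult_pos_neg)
    then show False using bridge[OF p pos(3)] byr by (simp add: mult_less_0_iff)
  qed
  show "\<not> T y x r p"
  proof
    assume t: "T y x r p"
    then have pos: "0 < D y x p" "0 < D x r p" "0 < D r y p" by (auto simp: in_triangle_def)
    have "0 < D y x r * D r b p"
      unfolding barycentric_ori[of u v y x r r b p] using pos x y
      by (simp add: add_pos_pos)
    then have "0 < D r b p" using yxr by (simp add: zero_less_mult_iff)
    from bridge[OF p this] show False using pos(1) by (simp add: ori_swap[of u v y x p])
  qed
qed

text \<open>Beyond the line b b' the wedge at r between b and b' lies wholly on the blue side, so a
  red point of the wedge is in the triangle.\<close>

lemma wedge_in_triangle:
  assumes "r \<in> R" "x \<in> R" "b \<in> B" "b' \<in> B" and pos: "0 < D r b b'" "0 < D r b x" "0 < D r x b'"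
  shows "T r b b' x"
proof -
  have b'r: "0 < D b' r x" using pos(3) by (simp add: ori_rotate[of u v r x b', symmetric] ori_rotate[of u v x b' r, symmetric])
  have neg: "u \<bullet> x - c < 0" "u \<bullet> r - c < 0" "0 < u \<bullet> b - c" "0 < u \<bullet> b' - c"
    using assms red blue by auto
  have "0 < D b b' x"
  proof (rule ccontr)
    assume "\<not> 0 < D b b' x"
    then have "0 \<le> D b b' x * (u \<bullet> r - c)" using neg by (simp add: mult_nonpos_nonpos)
    moreover have "0 < D b' r x * (u \<bullet> b - c)" "0 < D r b x * (u \<bullet> b' - c)"
      using neg b'r pos by simp_all
    ultimately have "0 < D r b b' * (u \<bullet> x - c)"
      using barycentric_inner[of u v r b b' x c] by linarith
    then show False using pos neg by (simp add: zero_less_mult_iff)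
  qed
  then show ?thesis using pos b'r by (simp add: in_triangle_def)
qed

lemma above_bridge_in_triangle:
  assumes r: "r \<in> R" and b: "b \<in> B" and x: "x \<in> R" "0 < D r b x" and y: "y \<in> B" "0 < D r b y"
    and bridge: "\<And>p. p \<in> R \<union> B \<Longrightarrow> 0 < D r b p \<Longrightarrow> 0 \<le> D x y p"
    and above: "0 < D x y r" and b': "next_around u v B r b b'"
  shows "T r b b' x"
proof (rule wedge_in_triangle[OF r x(1) b])
  show b'B: "b' \<in> B" "0 < D r b b'" using b' by (auto simp: next_around_def)
  show "0 < D r b x" by fact
  have yb': "0 \<le> D r b' y" using b' y by (auto simp: next_around_def)
  have neq: "r \<noteq> x" "r \<noteq> b'" "x \<noteq> b'" using x disjoint b'B r by auto
  have "D r x b' \<noteq> 0" using D_nonzero[of r x b'] r x b'B neq by auto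
  moreover have "\<not> D r x b' < 0"
  proof
    assume n: "D r x b' < 0"
    have sgn: "u \<bullet> x - c < 0" "u \<bullet> r - c < 0" "0 < u \<bullet> y - c" "0 < u \<bullet> b' - c"
      using r x y b'B red blue by auto
    have "0 < D r x y * (u \<bullet> b' - c)" using above sgn by (simp add: ori_rotate[of u v x y r])
    moreover have "D x y b' * (u \<bullet> r - c) \<le> 0"
      using bridge[of b'] b'B sgn by (simp add: mult_nonneg_nonpos)
    moreover have "D y r b' * (u \<bullet> x - c) \<le> 0"
      using yb' sgn by (simp add: mult_nonneg_nonpos ori_rotate[of u v r b' y])
    moreover have "D r x b' * (u \<bullet> y - c) < 0" using n sgn by (simp add: mult_neg_pos)
    \<comment> \<open>Over the triangle r x y, b' would have nonnegative weights at the red points r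
      and x and a negative weight at the blue point y, which puts it on the red side.\<close>
    ultimately show False using barycentric_inner[of u v r x y b' c] by linarith
  qed
  ultimately show "0 < D r x b'" by linarith
qed

lemma no_blue_before_next:
  assumes b': "next_around u v B r b b'" and q: "q \<in> B"
  shows "\<not> T r b b' q"
proof
  assume "T r b b' q"
  then have "0 < D r b q" "0 < D b' r q" by (auto simp: in_triangle_def)
  then show False using b' q ori_swap[of u v b' r q] by (force simp: next_around_def)
qed

text \<open>Of the three triangles into which x splits the triangle r b b', at most one contains the
  possible further point; deleting that one leaves an empty quadrilateral.\<close>

lemma good_if_few_in_triangle:
  assumes r: "r \<in> R" and b: "b \<in> B" and b': "next_around u v B r b b'"
    and ne: "x \<in> R" "T r b b' x" and few: "card {x \<in> R. T r b b' x} < 3"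
  shows "good r b"
proof -
  let ?X = "{x \<in> R. T r b b' x}"
  have b'B: "b' \<in> B" "b \<noteq> b'" using b' by (auto simp: next_around_def)
  have pos: "0 < D r b x" "0 < D b b' x" "0 < D b' r x" using ne by (auto simp: in_triangle_def)
  have xr: "r \<noteq> x" using pos by auto
  have sub: "p \<in> ?X - {x}" if "p \<in> R \<union> B" "T r b x p \<or> T b b' x p \<or> T b' r x p" for p
  proof -
    have "T r b b' p"
      using that ne in_triangle_trans[of u v r b b' x p] in_triangle_trans[of u v b b' r x p]
        in_triangle_trans[of u v b' r b x p] by (auto simp: in_triangle_rotate)
    moreover have "p \<noteq> x" using that by (auto simp: in_triangle_def)
    ultimately show ?thesis using that no_blue_before_next[OF b'] by auto
  qed
  have "card (?X - {x}) \<le> 1" using few ne finite by simp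
  then have uniq: "p = q" if "p \<in> ?X - {x}" "q \<in> ?X - {x}" for p q
    using that finite card_le_Suc0_iff_eq[of "?X - {x}"] by simp
  have disj: "\<not> (T r b x p \<and> T b b' x p)" "\<not> (T b b' x p \<and> T b' r x p)" "\<not> (T r b x p \<and> T b' r x p)" for p
    by (auto simp: in_triangle_def ori_swap[of u v x b p] ori_swap[of u v x b' p] ori_swap[of u v x r p])
  define E where "E a d \<longleftrightarrow> (\<forall>p\<in>R \<union> B. \<not> T a d x p)" for a d
  have "E r b \<or> E b b'" unfolding E_def using sub uniq disj(1) by blast
  moreover have "E b b' \<or> E b' r" unfolding E_def using sub uniq disj(2) by blast
  moreover have "E r b \<or> E b' r" unfolding E_def using sub uniq disj(3) by blast
  ultimately consider "E r b" "E b b'" | "E b b'" "E b' r" | "E b' r" "E r b" by blast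
  then show ?thesis
  proof cases
    case 1
    show ?thesis by (rule goodI[OF r ne(1) b b'B(1) xr b'B(2), of r b b' x]) (use 1 pos in \<open>auto simp: E_def\<close>)
  next
    case 2
    show ?thesis by (rule goodI[OF r ne(1) b b'B(1) xr b'B(2), of b b' r x]) (use 2 pos in \<open>auto simp: E_def\<close>)
  next
    case 3
    show ?thesis by (rule goodI[OF r ne(1) b b'B(1) xr b'B(2), of b' r b x]) (use 3 pos in \<open>auto simp: E_def\<close>)
  qed
qed

text \<open>Minimise \<open>D r b\<close>, a measure of area. A red point inside the minimal
  triangle would give a smaller one, which is free of blue points because it is contained in
  it.\<close>

lemma obtain_empty_triangle:
  assumes "x \<in> R" "0 < D r b x" "\<And>q. q \<in> B \<Longrightarrow> \<not> T r b x q"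
  obtains x' where "x' \<in> R" "0 < D r b x'" "\<And>q. q \<in> R \<union> B \<Longrightarrow> \<not> T r b x' q"
proof -
  let ?A = "{x \<in> R. 0 < D r b x \<and> (\<forall>q\<in>B. \<not> T r b x q)}"
  have "finite ?A" "?A \<noteq> {}" using finite assms by auto
  then obtain m where m: "m \<in> ?A" "\<And>z. z \<in> ?A \<Longrightarrow> D r b m \<le> D r b z"
    using arg_min_if_finite[of ?A "D r b"] by (metis (no_types, lifting) linorder_not_less)
  have "\<not> T r b m q" if "q \<in> R" for q
  proof
    assume t: "T r b m q"
    then have "q \<in> ?A" using that m in_triangle_trans[OF t] by (auto simp: in_triangle_def)
    then have "D r b m \<le> D r b q" using m by blast
    then show False using t ori_split[of u v r b m q] by (auto simp: in_triangle_def)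
  qed
  then have "\<not> T r b m q" if "q \<in> R \<union> B" for q using that m by auto
  then show ?thesis using that[of m] m by auto
qed

text \<open>Slope of the line r p in the coordinates u, v. Over points with larger u than r it
  increases along the rotation about r, which gives the real keys that \<open>card_gap_bound\<close>
  expects.\<close>

definition key :: "point \<Rightarrow> point \<Rightarrow> real" where
  "key r p = (v \<bullet> (p - r)) / (u \<bullet> (p - r))"

lemma key_less_iff:
  assumes "u \<bullet> r < u \<bullet> p" "u \<bullet> r < u \<bullet> q"
  shows "key r p < key r q \<longleftrightarrow> 0 < D r p q"
proof -
  have "0 < u \<bullet> (p - r)" "0 < u \<bullet> (q - r)" using assms by (simp_all add: inner_diff_right)
  then show ?thesis unfolding key_def ori_def by (simp add: divide_simps mult.commute)
qed

lemma obtain_next: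
  assumes r: "r \<in> R" and q: "q \<in> B" "0 < D r b q"
  obtains b' where "next_around u v B r b b'"
proof -
  let ?A = "{q \<in> B. 0 < D r b q}"
  have "finite ?A" "?A \<noteq> {}" using finite q by auto
  then obtain m where m: "m \<in> ?A" "\<And>z. z \<in> ?A \<Longrightarrow> key r m \<le> key r z"
    using arg_min_if_finite[of ?A "key r"] by (metis (no_types, lifting) linorder_not_less)
  have "0 \<le> D r m z" if "z \<in> B" "0 < D r b z" for z
  proof -
    have "u \<bullet> r < u \<bullet> m" "u \<bullet> r < u \<bullet> z" using that m(1) r red blue by force+
    then have "\<not> 0 < D r z m" using m(2)[of z] that key_less_iff[of r z m] by auto
    then show ?thesis by (simp add: ori_swap'[of u v r z m])
  qed
  then have "next_around u v B r b m" using m by (auto simp: next_around_def)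
  then show ?thesis by (rule that)
qed

text \<open>Without blue points on that side \<open>crowded\<close> holds by default, and every
  triangle r b x is free of blue points.\<close>

lemma red_side_if_only_red:
  assumes "x \<in> R" "0 < D r b x" and nb: "\<And>q. q \<in> B \<Longrightarrow> \<not> 0 < D r b q"
  shows "red_side u v R B r b"
proof -
  have "\<not> T r b x q" if "q \<in> B" for q using nb[OF that] by (auto simp: in_triangle_def)
  then show ?thesis unfolding red_side_def crowded_def
    using obtain_empty_triangle[OF assms(1,2)] nb by (metis next_around_def)
qed

lemma red_side_if_above_bridge:
  assumes r: "r \<in> R" and b: "b \<in> B" and bad: "\<not> good r b"
    and x: "x \<in> R" "0 < D r b x" and y: "y \<in> B" "0 < D r b y"
    and bridge: "\<And>p. p \<in> R \<union> B \<Longrightarrow> 0 < D r b p \<Longrightarrow> 0 \<le> D x y p"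
    and above: "0 < D x y r"
  shows "red_side u v R B r b"
proof -
  obtain b' where b': "next_around u v B r b b'" using obtain_next[OF r y] .
  have t: "T r b b'' x" if "next_around u v B r b b''" for b''
    by (rule above_bridge_in_triangle[OF r b x y bridge above that])
  have "crowded u v R B r b" unfolding crowded_def
    using good_if_few_in_triangle[OF r b _ x(1) t] bad by (meson linorder_not_less)
  \<comment> \<open>The triangle r b x lies in r b b', which has no blue point inside.\<close>
  moreover have "\<not> T r b x q" if "q \<in> B" for q
    using in_triangle_trans[OF t[OF b']] no_blue_before_next[OF b' that] by blast
  then obtain x' where "x' \<in> R" "0 < D r b x'" "\<And>q. q \<in> R \<union> B \<Longrightarrow> \<not> T r b x' q"
    using obtain_empty_triangle[OF x] by metis
  ultimately show ?thesis unfolding red_side_def by blast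
qed

section \<open>The two sides of a pair that is not good\<close>

lemma side_cases:
  assumes r: "r \<in> R" and b: "b \<in> B" and bad: "\<not> good r b"
  shows "(\<forall>p\<in>R \<union> B. \<not> 0 < D r b p) \<or> red_side u v R B r b \<or> red_side (- u) v B R b r"
proof -
  interpret swapped: separated_sets B R "- u" v "- c" by (rule swap)
  \<comment> \<open>Exchanging the colours also exchanges r and b, and this sign cancels the one
    from \<open>- u\<close>.\<close>
  have o: "ori (- u) v y x p = D x y p" for x y p
    by (simp add: ori_uminus_left ori_swap[of u v y x])
  consider "\<forall>p\<in>R \<union> B. \<not> 0 < D r b p"
    | x where "x \<in> R" "0 < D r b x" "\<forall>q\<in>B. \<not> 0 < D r b q"
    | y where "y \<in> B" "0 < D r b y" "\<forall>q\<in>R. \<not> 0 < D r b q"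
    | x y where "x \<in> R" "0 < D r b x" "y \<in> B" "0 < D r b y"
    by blast
  then show ?thesis
  proof cases
    case 2
    then show ?thesis using red_side_if_only_red by blast
  next
    case 3
    then show ?thesis using swapped.red_side_if_only_red[of y b r] by (simp add: o)
  next
    case 4
    obtain x y where x: "x \<in> {x \<in> R. 0 < D r b x}" and y: "y \<in> {y \<in> B. 0 < D r b y}"
      and br: "\<And>p. p \<in> {x \<in> R. 0 < D r b x} \<union> {y \<in> B. 0 < D r b y} \<Longrightarrow> 0 \<le> D x y p"
      by (rule obtain_bridge[of "{x \<in> R. 0 < D r b x}" "{y \<in> B. 0 < D r b y}"]) (use 4 in auto)
    have x: "x \<in> R" "0 < D r b x" and y: "y \<in> B" "0 < D r b y" using x y by auto
    have bridge: "0 \<le> D x y p" if "p \<in> R \<union> B" "0 < D r b p" for p using br that by auto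
    have "x \<noteq> r" "y \<noteq> b" "x \<noteq> y" "x \<noteq> b" "y \<noteq> r" using x y r b disjoint by auto
    then have "D x y r \<noteq> 0" "D x y b \<noteq> 0" using D_nonzero[of x y] x y r b by auto
    then consider "0 < D x y r" | "0 < D x y b" | "D x y r < 0" "D x y b < 0" by linarith
    then show ?thesis
    proof cases
      case 1
      then show ?thesis using red_side_if_above_bridge[OF r b bad x y bridge] by blast
    next
      case 2
      have "red_side (- u) v B R b r"
        by (rule swapped.red_side_if_above_bridge[OF b r _ y(1) _ x(1)])
          (use 2 bad bridge x y in \<open>auto simp: o in_balanced_4hole_swap\<close>)
      then show ?thesis by blast
    next
      case 3
      then show ?thesis using good_if_below_bridge[OF r b x y bridge] bad by blast
    qed
  qed blast
qed

text \<open>The empty triangles on the two sides, one with a red and one with a blue apex, are glued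
  along r b, which becomes a diagonal.\<close>

lemma good_if_opposite_sides:
  assumes r: "r \<in> R" and b: "b \<in> B"
    and red: "red_side u v R B r b" and blue: "red_side (- u) (- v) B R b r"
  shows "good r b"
proof -
  obtain x where x: "x \<in> R" "0 < D r b x" "\<And>q. q \<in> R \<union> B \<Longrightarrow> \<not> T r b x q"
    using red by (auto simp: red_side_def)
  have o: "ori (- u) (- v) = D" by (intro ext) (simp add: ori_uminus_left ori_uminus_right)
  have t: "in_triangle (- u) (- v) = T" by (intro ext) (simp add: in_triangle_def o)
  obtain y where y: "y \<in> B" "0 < D b r y" "\<And>q. q \<in> R \<union> B \<Longrightarrow> \<not> T b r y q"
    using blue by (auto simp: red_side_def o t)
  show ?thesis
  proof (rule goodI[OF r x(1) b y(1), of x r y b])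
    show "r \<noteq> x" "b \<noteq> y" using x y by auto
    show "{x, r, y, b} = {r, x, b, y}" by auto
    show "0 < D x r b" using x(2) by (simp add: ori_rotate[of u v r b x])
    show "0 < D r y b" using y(2) by (simp add: ori_rotate[of u v r y b])
    show "\<not> T x r b p" if "p \<in> R \<union> B" for p
      using x(3)[OF that] in_triangle_rotate[of u v r b x p] by simp
    show "\<not> T r y b p" if "p \<in> R \<union> B" for p
      using y(3)[OF that] in_triangle_rotate[of u v r y b p] by simp
  qed
qed

text \<open>By \<open>side_cases\<close> each side of r b is empty, of red kind or of blue kind. One
  of each kind is excluded by \<open>good_if_opposite_sides\<close>, and an empty side is crowded by
  default for both colours, so some colour is crowded on both sides.\<close>

lemma crowded_if_bad:
  assumes r: "r \<in> R" and b: "b \<in> B" and bad: "\<not> good r b"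
  shows "crowded u v R B r b \<and> crowded u (- v) R B r b \<or>
    crowded (- u) v B R b r \<and> crowded (- u) (- v) B R b r"
proof -
  interpret flipped: separated_sets R B u "- v" c by (rule flip)
  have empty: "crowded u w R B r b \<and> crowded (- u) w B R b r"
    if "\<forall>p\<in>R \<union> B. \<not> 0 < ori u w r b p" for w
    using that by (auto simp: crowded_def next_around_def ori_uminus_left ori_swap[of u w b r])
  have "\<not> (red_side u v R B r b \<and> red_side (- u) (- v) B R b r)"
    using good_if_opposite_sides[OF r b] bad by blast
  moreover have "\<not> (red_side u (- v) R B r b \<and> red_side (- u) v B R b r)"
    using flipped.good_if_opposite_sides[OF r b] bad by auto
  ultimately show ?thesis
    using side_cases[OF r b bad] flipped.side_cases[OF r b bad] empty[of v] empty[of "- v"]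
    unfolding red_side_def by blast
qed

section \<open>Counting the crowded pairs\<close>

lemma card_crowded_le:
  assumes r: "r \<in> R" and eq: "card R = card B" and two: "2 \<le> card B"
  shows "3 * card {b \<in> B. crowded u v R B r b \<and> crowded u (- v) R B r b} \<le> card {x \<in> R. u \<bullet> r < u \<bullet> x}"
proof -
  let ?F = "{x \<in> R. u \<bullet> r < u \<bullet> x}"
  let ?Bad = "{b \<in> B. crowded u v R B r b \<and> crowded u (- v) R B r b}"
  have ub: "u \<bullet> r < u \<bullet> b" if "b \<in> B" for b using r that red blue by force
  have kl: "key r p < key r q \<longleftrightarrow> 0 < D r p q" if "p \<in> B" "q \<in> B" for p q
    using key_less_iff ub that by blast
  have inj: "inj_on (key r) B"
  proof (rule inj_onI, rule ccontr)
    fix p q assume pq: "p \<in> B" "q \<in> B" "key r p = key r q" "p \<noteq> q"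
    then have "\<not> 0 < D r p q" "\<not> 0 < D r q p" using kl[of p q] kl[of q p] by auto
    then have "D r p q = 0" by (simp add: ori_swap'[of u v r q p])
    then show False using D_nonzero[of r p q] r pq disjoint by auto
  qed
  have inj': "inj_on (key r) ?Bad" using inj by (rule inj_on_subset) auto
  \<comment> \<open>\<open>?F\<close> omits r itself, so there are fewer separating points than blue
    points, as \<open>card_gap_bound\<close> demands.\<close>
  have "card ?F < card R" by (rule psubset_card_mono) (use r finite in auto)
  then have less: "card ?F < card (key r ` B)" using eq card_image[OF inj] by simp
  have "3 * card (key r ` ?Bad) \<le> card ?F"
  proof (rule card_gap_bound[OF _ _ less, where k = "key r"])
    show "finite (key r ` B)" "finite ?F" using finite by auto
    show "2 \<le> card (key r ` B)" using two card_image[OF inj] by simp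
    show "key r ` ?Bad \<subseteq> key r ` B" by auto
    fix s t
    assume "s \<in> key r ` B" "t \<in> key r ` B" and st: "s < t" and between: "key r ` B \<inter> {s<..<t} = {}"
      and badst: "s \<in> key r ` ?Bad \<or> t \<in> key r ` ?Bad"
    then obtain b b' where b: "b \<in> B" "s = key r b" and b': "b' \<in> B" "t = key r b'" by auto
    have bad: "b \<in> ?Bad \<or> b' \<in> ?Bad" using badst b b' inj by (auto dest: inj_onD)
    have pos: "0 < D r b b'" using st b b' kl by simp
    have no: "\<not> (0 < D r b q \<and> 0 < D r q b')" if "q \<in> B" for q
      using between that b b' kl by auto
    have "3 \<le> card {x \<in> R. T r b b' x}"
      using bad
    proof
      assume "b \<in> ?Bad"
      moreover have "next_around u v B r b b'"
        using b' pos no by (force simp: next_around_def ori_swap'[of u v r _ b'] not_less)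
      ultimately show ?thesis by (auto simp: crowded_def)
    next
      assume "b' \<in> ?Bad"
      \<comment> \<open>In the reversed rotation b follows b', and the triangle is the same
        set.\<close>
      moreover have "next_around u (- v) B r b' b"
        using b pos no
        by (force simp: next_around_def ori_uminus_right ori_swap'[of u v r b'] not_less)
      ultimately show ?thesis by (auto simp: crowded_def in_triangle_flip)
    qed
    also have "\<dots> \<le> card {x \<in> ?F. s < key r x \<and> key r x < t}"
    proof (rule card_mono)
      show "finite {x \<in> ?F. s < key r x \<and> key r x < t}" using finite by simp
      show "{x \<in> R. T r b b' x} \<subseteq> {x \<in> ?F. s < key r x \<and> key r x < t}"
      proof clarify
        fix x assume x: "x \<in> R" "T r b b' x"
        then have p: "0 < D r b x" "0 < D b' r x" by (auto simp: in_triangle_def)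
        \<comment> \<open>Since b and b' have larger u than r, so has every point inside the
          triangle: red ones are closer to the separating line than r.\<close>
        have "0 < D r b b' * (u \<bullet> x - u \<bullet> r)"
          unfolding barycentric_inner[of u v r b b' x] using p ub[OF b(1)] ub[OF b'(1)] by (simp add: add_pos_pos)
        then have ux: "u \<bullet> r < u \<bullet> x" using pos by (simp add: zero_less_mult_iff)
        have "0 < D r x b'" using p(2) by (simp add: ori_rotate[of u v r x b'])
        then show "x \<in> ?F \<and> s < key r x \<and> key r x < t"
          using key_less_iff ux ub b b' p x by auto
      qed
    qed
    finally show "3 \<le> card {x \<in> ?F. s < key r x \<and> key r x < t}" .
  qed
  then show ?thesis using card_image[OF inj'] by simp
qed

lemma sum_card_crowded_le:
  assumes eq: "card R = n" "card B = n" and two: "2 \<le> n"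
  shows "6 * card (SIGMA r:R. {b \<in> B. crowded u v R B r b \<and> crowded u (- v) R B r b}) + 3 * n \<le> n ^ 2 + 2"
proof -
  let ?Bad = "\<lambda>r. {b \<in> B. crowded u v R B r b \<and> crowded u (- v) R B r b}"
  have "card (SIGMA r:R. ?Bad r) = (\<Sum>r\<in>R. card (?Bad r))" using finite by simp
  also have "\<dots> \<le> (\<Sum>r\<in>R. card {x \<in> R. u \<bullet> r < u \<bullet> x} div 3)"
    by (rule sum_mono) (use card_crowded_le eq two in \<open>simp add: less_eq_div_iff_mult_less_eq mult.commute\<close>)
  also have "\<dots> \<le> (\<Sum>i<n. i div 3)" using sum_card_above_div_3[OF finite(1)] eq by simp
  finally show ?thesis using sum_div_3_le[of n] by linarith
qed

end

section \<open>From pairs to holes\<close>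

lemma card_pairs_in_balanced_4hole_le:
  assumes "finite R" "finite B"
  shows "card {(r, b) \<in> R \<times> B. in_balanced_4hole R B r b} \<le> 4 * card (balanced_4holes R B)"
proof -
  let ?H = "balanced_4holes R B"
  \<comment> \<open>The vertices are recovered as the union of the edges, so a hole, given as an
    edge set, determines its 2 * 2 red-blue pairs.\<close>
  have U: "\<Union> (quad_edges a b c d) = {a, b, c, d}" for a b c d by (auto simp: quad_edges_def)
  have "?H \<subseteq> Pow (Pow (R \<union> B))"
    by (auto simp: balanced_4holes_def quad_edges_def four_hole_def)
  then have fin: "finite ?H" using assms by (meson finite_Pow_iff finite_UnI finite_subset)
  have four: "card ((\<Union> h \<inter> R) \<times> (\<Union> h \<inter> B)) = 4" if "h \<in> ?H" for h
    using that by (auto simp: balanced_4holes_def U card_cartesian_product)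
  have "{(r, b) \<in> R \<times> B. in_balanced_4hole R B r b} \<subseteq> (\<Union>h\<in>?H. (\<Union> h \<inter> R) \<times> (\<Union> h \<inter> B))"
  proof clarify
    fix r b assume rb: "r \<in> R" "b \<in> B" "in_balanced_4hole R B r b"
    then obtain w x y z where h: "four_hole (R \<union> B) w x y z" "card ({w, x, y, z} \<inter> R) = 2"
      "card ({w, x, y, z} \<inter> B) = 2" "{r, b} \<subseteq> {w, x, y, z}"
      by (auto simp: in_balanced_4hole_def)
    then have "quad_edges w x y z \<in> ?H" unfolding balanced_4holes_def by blast
    moreover have "r \<in> \<Union> (quad_edges w x y z)" "b \<in> \<Union> (quad_edges w x y z)" using h(4) U by auto
    ultimately show "(r, b) \<in> (\<Union>h\<in>?H. (\<Union> h \<inter> R) \<times> (\<Union> h \<inter> B))" using rb by blast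
  qed
  moreover have "finite (\<Union>h\<in>?H. (\<Union> h \<inter> R) \<times> (\<Union> h \<inter> B))" using fin assms by auto
  ultimately have "card {(r, b) \<in> R \<times> B. in_balanced_4hole R B r b}
      \<le> card (\<Union>h\<in>?H. (\<Union> h \<inter> R) \<times> (\<Union> h \<inter> B))" by (rule card_mono[rotated])
  also have "\<dots> \<le> (\<Sum>h\<in>?H. card ((\<Union> h \<inter> R) \<times> (\<Union> h \<inter> B)))" by (rule card_UN_le[OF fin])
  also have "\<dots> = 4 * card ?H" using four by simp
  finally show ?thesis .
qed

theorem theorem2:
  fixes R B :: "point set" and n :: nat
  assumes "finite R" and "finite B" and "R \<inter> B = {}"
    and "card R = n" and "card B = n"
    and "general_position (R \<union> B)"
    and "linearly_separable R B"
  shows "real (card (balanced_4holes R B)) \<ge> (2 * real n ^ 2 + 3 * real n - 8) / 12"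
proof (cases "2 \<le> n")
  case False
  \<comment> \<open>In both cases the claimed bound is negative.\<close>
  then have "n = 0 \<or> n = 1" by auto
  then have "(2 * real n ^ 2 + 3 * real n - 8) / 12 \<le> 0" by auto
  then show ?thesis by (meson of_nat_0_le_iff order_trans)
next
  case True
  obtain u c where u: "u \<noteq> 0" "\<And>r. r \<in> R \<Longrightarrow> u \<bullet> r < c" "\<And>b. b \<in> B \<Longrightarrow> c < u \<bullet> b"
    using assms(7) by (auto simp: linearly_separable_def)
  \<comment> \<open>u turned by a right angle, so that u and v give orthogonal coordinates.\<close>
  define v :: point where "v = vector [- (u $ 2), u $ 1]"
  have indep: "z = 0" if "u \<bullet> z = 0" "v \<bullet> z = 0" for z
  proof -
    have e: "u $ 1 * z $ 1 + u $ 2 * z $ 2 = 0" "u $ 1 * z $ 2 - u $ 2 * z $ 1 = 0"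
      using that by (simp_all add: inner_vec_def sum_2 v_def)
    have "((u $ 1)\<^sup>2 + (u $ 2)\<^sup>2) * z $ 1 = 0" "((u $ 1)\<^sup>2 + (u $ 2)\<^sup>2) * z $ 2 = 0"
      using e by algebra+
    moreover have "(u $ 1)\<^sup>2 + (u $ 2)\<^sup>2 \<noteq> 0"
      using u(1) by (simp add: sum_power2_eq_zero_iff vec_eq_iff forall_2)
    ultimately show ?thesis by (auto simp: vec_eq_iff forall_2)
  qed
  interpret separated_sets R B u v c by unfold_locales (use assms u indep in auto)
  interpret swapped: separated_sets B R "- u" v "- c" by (rule swap)
  let ?G = "{(r, b) \<in> R \<times> B. good r b}"
  let ?P = "SIGMA r:R. {b \<in> B. crowded u v R B r b \<and> crowded u (- v) R B r b}"
  let ?Q = "SIGMA b:B. {r \<in> R. crowded (- u) v B R b r \<and> crowded (- u) (- v) B R b r}"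
  \<comment> \<open>By \<open>crowded_if_bad\<close> a pair outside \<open>?G\<close> is crowded
    about its red point (\<open>?P\<close>) or about its blue point (\<open>?Q\<close>, where the
    blue point comes first).\<close>
  have "R \<times> B \<subseteq> ?G \<union> ?P \<union> prod.swap ` ?Q"
  proof
    fix z assume "z \<in> R \<times> B"
    then obtain r b where z: "z = (r, b)" "r \<in> R" "b \<in> B" by auto
    show "z \<in> ?G \<union> ?P \<union> prod.swap ` ?Q"
      using crowded_if_bad[OF z(2,3)] z by (cases "good r b") (auto simp: image_iff)
  qed
  moreover have fin: "finite ?G" "finite ?P" "finite ?Q"
    using finite by (auto intro: finite_subset[of _ "R \<times> B"] finite_subset[of _ "B \<times> R"])
  ultimately have "card (R \<times> B) \<le> card (?G \<union> ?P \<union> prod.swap ` ?Q)"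
    by (intro card_mono) auto
  also have "\<dots> \<le> card ?G + card ?P + card ?Q"
    using card_Un_le[of "?G \<union> ?P" "prod.swap ` ?Q"] card_Un_le[of ?G ?P] card_image_le[OF fin(3), of prod.swap]
    by linarith
  finally have "n ^ 2 \<le> card ?G + card ?P + card ?Q"
    using assms(4,5) by (simp add: card_cartesian_product power2_eq_square)
  moreover have "6 * card ?P + 3 * n \<le> n ^ 2 + 2"
    by (rule sum_card_crowded_le) (use assms True in auto)
  moreover have "6 * card ?Q + 3 * n \<le> n ^ 2 + 2"
    by (rule swapped.sum_card_crowded_le) (use assms True in auto)
  moreover have "card ?G \<le> 4 * card (balanced_4holes R B)"
    by (rule card_pairs_in_balanced_4hole_le[OF assms(1,2)])
  \<comment> \<open>The bounds give 6 * card \<open>?G\<close> >= 4n^2 + 6n - 4. With four pairs per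
    hole this leaves the constant 2, where the goal allows 8.\<close>
  ultimately have "2 * n ^ 2 + 3 * n \<le> 12 * card (balanced_4holes R B) + 2" by linarith
  then have "real (2 * n ^ 2 + 3 * n) \<le> real (12 * card (balanced_4holes R B) + 2)"
    by (rule of_nat_mono)
  then show ?thesis by simp
qed

end
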